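(* Let $K, L_1, L_2 \subseteq \mathbb{R}^n$ be convex bodies with $0 \in \operatorname{int}(L_1) \cap \operatorname{int}(L_2)$, let $c, d \in \mathbb{R}^n$ be vectors, and let $r, R > 0$ be reals such that the containment chain $r L_1 + c \subseteq K \subseteq R L_2 + d$ is affinely-optimal. Then the following conditions are satisfied: (i) For any matrix $A \in \mathbb{R}^{n \times n}$ and any vectors $v, w \in \mathbb{R}^n$, there exist a contact pair $(y,a)$ of $K$ and $r L_1 + c$ and a contact pair $(z,b)$ of $K$ and $R L_2 + d$ such that $$\langle a, A y + v \rangle \leq \langle b, A z + w \rangle \quad \text{and} \quad \langle a, y - c \rangle = \langle b, z - d \rangle = 1.$$ (ii) There exist integers $N, M \geq 1$, contact pairs $(y^1,a^1), \ldots, (y^N,a^N)$ of $K$ and $r L_1 + c$, contact pairs $(z^1,b^1), \ldots, (z^M,b^M)$ of $K$ and $R L_2 + d$, as well as weights $\lambda_1, \ldots, \lambda_N, \mu_1, \ldots, \mu_M > 0$ such that for any $x \in \mathbb{R}^n$, $$\sum_{i=1}^N \lambda_i \langle x, a^i \rangle y^i = \sum_{j=1}^M \mu_j \langle x, b^j \rangle z^j \quad \text{and} \quad \sum_{i=1}^N \lambda_i a^i = \sum_{j=1}^M \mu_j b^j = 0.$$ In this case (i.e., for a decomposition as in (ii)), $\sum_{i=1}^N \lambda_i \langle y^i, a^i \rangle = \sum_{j=1}^M \mu_j \langle z^j, b^j \rangle$, and there exists a choice of the decomposition in (ii) with $N + M \leq (n+1)^2$.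
   Context: A convex body in $\mathbb{R}^n$ is a compact convex set with non-empty interior. $\langle \cdot, \cdot \rangle$ is the standard inner product, $\operatorname{int}$ denotes interior and $\operatorname{bd}$ denotes boundary. For convex bodies $K, L_1, L_2 \subseteq \mathbb{R}^n$, vectors $c, d \in \mathbb{R}^n$, and reals $r, R > 0$ with $r L_1 + c \subseteq K \subseteq R L_2 + d$, this containment chain is called affinely-optimal if for any linear operator $T$ on $\mathbb{R}^n$, vectors $c', d' \in \mathbb{R}^n$, and reals $r', R' > 0$ with $r' L_1 + c' \subseteq T(K) \subseteq R' L_2 + d'$ we have $\frac{R'}{r'} \geq \frac{R}{r}$. For two convex bodies, one contained in the other, say $C \subseteq D$, a contact pair $(y,a)$ of the two bodies consists of a point $y \in \operatorname{bd}(C) \cap \operatorname{bd}(D)$ and a non-zero $a \in \mathbb{R}^n$ such that $\langle a, y \rangle \geq \langle a, x \rangle$ for every $x \in D$ (the larger body). Thus for contact pairs of $K$ and $r L_1 + c$ the larger body is $K$, and for contact pairs of $K$ and $R L_2 + d$ the larger body is $R L_2 + d$. *)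

theory Defs
  imports "HOL-Analysis.Analysis"
begin

definition convex_body :: "(real ^ 'n) set \<Rightarrow> bool" where
  "convex_body K \<longleftrightarrow> compact K \<and> convex K \<and> interior K \<noteq> {}"

definition homothet :: "real \<Rightarrow> (real ^ 'n) set \<Rightarrow> real ^ 'n \<Rightarrow> (real ^ 'n) set" where
  "homothet r L c = (\<lambda>x. r *\<^sub>R x + c) ` L"

(* The operator T is not required to be invertible. *)
definition affinely_optimal ::
  "real \<Rightarrow> (real ^ 'n) set \<Rightarrow> real ^ 'n \<Rightarrow> (real ^ 'n) set \<Rightarrow>
   real \<Rightarrow> (real ^ 'n) set \<Rightarrow> real ^ 'n \<Rightarrow> bool" where
  "affinely_optimal r L1 c K R L2 d \<longleftrightarrow>
     homothet r L1 c \<subseteq> K \<and> K \<subseteq> homothet R L2 d \<and>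
     (\<forall>(T :: real ^ 'n \<Rightarrow> real ^ 'n) c' d' r' R'.
        linear T \<longrightarrow> r' > 0 \<longrightarrow> R' > 0 \<longrightarrow>
        homothet r' L1 c' \<subseteq> T ` K \<longrightarrow> T ` K \<subseteq> homothet R' L2 d' \<longrightarrow>
        R' / r' \<ge> R / r)"

(* The first argument C is meant to be the smaller body: it is only used with C \<subseteq> D,
   and a is an outer normal vector at y of the larger body D. *)
definition contact_pair ::
  "(real ^ 'n) set \<Rightarrow> (real ^ 'n) set \<Rightarrow> real ^ 'n \<Rightarrow> real ^ 'n \<Rightarrow> bool" where
  "contact_pair C D y a \<longleftrightarrow>
     y \<in> frontier C \<inter> frontier D \<and> a \<noteq> 0 \<and> (\<forall>x\<in>D. a \<bullet> y \<ge> a \<bullet> x)"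

(* Inner, K, Outer stand for the three bodies of a chain Inner \<subseteq> K \<subseteq> Outer.
   Only the values of the families on {1..N} and {1..M} matter. *)
definition contact_decomposition ::
  "(real ^ 'n) set \<Rightarrow> (real ^ 'n) set \<Rightarrow> (real ^ 'n) set \<Rightarrow>
   nat \<Rightarrow> (nat \<Rightarrow> real ^ 'n) \<Rightarrow> (nat \<Rightarrow> real ^ 'n) \<Rightarrow> (nat \<Rightarrow> real) \<Rightarrow>
   nat \<Rightarrow> (nat \<Rightarrow> real ^ 'n) \<Rightarrow> (nat \<Rightarrow> real ^ 'n) \<Rightarrow> (nat \<Rightarrow> real) \<Rightarrow> bool" where
  "contact_decomposition Inner K Outer N y a lam M z b mu \<longleftrightarrow>
     N \<ge> 1 \<and> M \<ge> 1 \<and>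
     (\<forall>i\<in>{1..N}. contact_pair Inner K (y i) (a i) \<and> lam i > 0) \<and>
     (\<forall>j\<in>{1..M}. contact_pair K Outer (z j) (b j) \<and> mu j > 0) \<and>
     (\<forall>x. (\<Sum>i=1..N. (lam i * (x \<bullet> a i)) *\<^sub>R y i) = (\<Sum>j=1..M. (mu j * (x \<bullet> b j)) *\<^sub>R z j)) \<and>
     (\<Sum>i=1..N. lam i *\<^sub>R a i) = 0 \<and> (\<Sum>j=1..M. mu j *\<^sub>R b j) = 0"

end

theory Submission
  imports Defs
begin

text \<open>
  Both conditions are the first-order optimality conditions for the chain
  \<open>r L1 + c \<subseteq> K \<subseteq> R L2 + d\<close> under perturbations of the identity. Suppose that for
  some matrix \<open>A\<close>, vectors \<open>v, w\<close> and reals \<open>t < t'\<close> the velocity field \<open>A y + v\<close> satisfies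
  \<open>\<langle>a, A y + v\<rangle> > t'\<close> at every contact pair of \<open>r L1 + c\<close> and \<open>K\<close> with \<open>\<langle>a, y - c\<rangle> = 1\<close>, and
  the field \<open>A z + w\<close> satisfies \<open>\<langle>b, A z + w\<rangle> < t\<close> at every contact pair of \<open>K\<close> and
  \<open>R L2 + d\<close> with \<open>\<langle>b, z - d\<rangle> = 1\<close>. At the inner contacts \<open>K\<close> then moves outwards faster
  than a body expanding about \<open>c\<close> at rate \<open>t'\<close>, and at the outer contacts it moves outwards
  slower than a body expanding about \<open>d\<close> at rate \<open>t\<close>. Away from the contacts there is room to
  spare, so for small \<open>\<epsilon> > 0\<close> the image of \<open>K\<close> under \<open>I + \<epsilon> A\<close> contains a translate of
  \<open>(1 + \<epsilon> t') r L1\<close> and lies in a translate of \<open>(1 + \<epsilon> t) R L2\<close>, which improves the ratio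
  \<open>R / r\<close>. The lemma \<open>affinely_optimal_first_order\<close> records that optimality excludes this;
  the uniformity in \<open>\<epsilon>\<close> comes from the compactness statement \<open>approximate_contact_pairs\<close>.

  The existence of a decomposition is dual to this. The triples \<open>(a y\<^sup>T, a, 0)\<close> and
  \<open>(- b z\<^sup>T, 0, b)\<close> of normalized contact pairs form a compact set in a space of dimension
  \<open>n\<^sup>2 + 2 n\<close>. A hyperplane separating its convex hull strictly from \<open>0\<close> is a triple
  \<open>(A, v, -w)\<close> of the excluded kind, so \<open>0\<close> lies in the hull
  (\<open>affinely_optimal_zero_in_hull\<close>). Caratheodory's theorem writes \<open>0\<close> as a convex
  combination of at most \<open>n\<^sup>2 + 2 n + 1 = (n + 1)\<^sup>2\<close> of the triples, and its three components
  are the three identities of (ii) (\<open>zero_in_hull_imp_decomposition\<close>).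

  Condition (i) follows from (ii) by averaging. Pairing the identity of (ii) with \<open>A\<close> shows
  that the weighted sums of \<open>\<langle>a, A y + v\<rangle>\<close> and of \<open>\<langle>b, A z + w\<rangle>\<close> agree, the translation
  terms vanishing because both families of normals are balanced
  (\<open>decomposition_trace\<close>). The case \<open>A = I\<close> is the equality of traces, which under the
  normalization says that the total weights agree as well. Hence the smallest inner value is
  at most the largest outer one.
\<close>

section \<open>Supporting vectors and contact pairs\<close>

lemma inner_interior_less_support:
  fixes u a :: "'a::euclidean_space"
  assumes "u \<in> interior D" "a \<noteq> 0" "\<forall>x\<in>D. a \<bullet> x \<le> h"
  shows "a \<bullet> u < h"
proof -
  obtain e where e: "e > 0" "ball u e \<subseteq> D"
    using assms(1) by (auto simp: mem_interior)
  define x where "x = u + (e / 2 / norm a) *\<^sub>R a"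
  have "dist u x < e" using e assms(2) by (simp add: x_def dist_norm)
  then have "a \<bullet> x \<le> h" using e assms(3) by auto
  moreover have "a \<bullet> x = a \<bullet> u + (e / 2 / norm a) * (a \<bullet> a)"
    by (simp add: x_def inner_add_right)
  moreover have "(e / 2 / norm a) * (a \<bullet> a) > 0"
    using e assms(2) by (intro mult_pos_pos) auto
  ultimately show ?thesis by linarith
qed

text \<open>
  A point with a supporting vector of the larger body cannot be interior to it, hence not to
  the smaller body either. The two frontier conditions therefore reduce to membership, and
  this form survives passing to limits.
\<close>

lemma contact_pair_iff:
  assumes "C \<subseteq> D" "closed C"
  shows "contact_pair C D y a \<longleftrightarrow> y \<in> C \<and> a \<noteq> 0 \<and> (\<forall>x\<in>D. a \<bullet> x \<le> a \<bullet> y)"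
proof
  assume "contact_pair C D y a"
  then show "y \<in> C \<and> a \<noteq> 0 \<and> (\<forall>x\<in>D. a \<bullet> x \<le> a \<bullet> y)"
    using assms frontier_subset_closed unfolding contact_pair_def by fastforce
next
  assume *: "y \<in> C \<and> a \<noteq> 0 \<and> (\<forall>x\<in>D. a \<bullet> x \<le> a \<bullet> y)"
  then have "y \<notin> interior D"
    using inner_interior_less_support[of y D a "a \<bullet> y"] by auto
  moreover have "y \<notin> interior C"
    using calculation interior_mono[OF assms(1)] by auto
  ultimately show "contact_pair C D y a"
    using * assms(1) closure_subset unfolding contact_pair_def frontier_def by fastforce
qed

definition normalized_contact_pairs ::
  "(real ^ 'n) set \<Rightarrow> (real ^ 'n) set \<Rightarrow> real ^ 'n \<Rightarrow> ((real ^ 'n) \<times> (real ^ 'n)) set" where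
  "normalized_contact_pairs C D u = {(y, a). contact_pair C D y a \<and> a \<bullet> (y - u) = 1}"

text \<open>
  The normalization places \<open>a\<close> in the polar body of \<open>D - u\<close>, which is bounded because \<open>D\<close>
  contains a ball around \<open>u\<close>.
\<close>

lemma compact_normalized_contact_pairs:
  assumes "C \<subseteq> D" "compact C" "u \<in> interior D"
  shows "compact (normalized_contact_pairs C D u)"
proof -
  obtain e where e: "e > 0" "ball u e \<subseteq> D"
    using assms(3) by (auto simp: mem_interior)
  have norm_bound: "norm a \<le> 2 / e" if a: "\<forall>x\<in>D. a \<bullet> (x - u) \<le> 1" for a
  proof (cases "a = 0")
    case False
    define x where "x = u + (e / 2 / norm a) *\<^sub>R a"
    have "dist u x < e" using e False by (simp add: x_def dist_norm)
    then have "a \<bullet> (x - u) \<le> 1" using e a by auto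
    moreover have "a \<bullet> (x - u) = e / 2 * norm a"
      using False by (simp add: x_def dot_square_norm power2_eq_square)
    ultimately show ?thesis using e by (simp add: field_simps)
  qed (use e in auto)
  let ?S = "(C \<times> cball 0 (2 / e)) \<inter> {p. snd p \<bullet> (fst p - u) = 1} \<inter>
              (\<Inter>x\<in>D. {p. snd p \<bullet> (x - u) \<le> 1})"
  have "normalized_contact_pairs C D u = ?S"
  proof (intro equalityI subsetI)
    fix p assume p: "p \<in> normalized_contact_pairs C D u"
    then have "\<forall>x\<in>D. snd p \<bullet> (x - u) \<le> 1" "fst p \<in> C" "snd p \<bullet> (fst p - u) = 1"
      using assms contact_pair_iff[OF assms(1) compact_imp_closed[OF assms(2)]]
      by (auto simp: normalized_contact_pairs_def inner_diff_right)
    then show "p \<in> ?S" using norm_bound by (auto simp: mem_Times_iff)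
  next
    fix p assume p: "p \<in> ?S"
    then have "\<forall>x\<in>D. snd p \<bullet> x \<le> snd p \<bullet> fst p"
      by (fastforce simp: inner_diff_right)
    moreover have "snd p \<noteq> 0" using p by auto
    ultimately show "p \<in> normalized_contact_pairs C D u"
      using p contact_pair_iff[OF assms(1) compact_imp_closed[OF assms(2)]]
      by (auto simp: normalized_contact_pairs_def)
  qed
  moreover have "compact ?S"
    by (intro compact_Int_closed compact_Times assms closed_INT ballI
        closed_Collect_eq closed_Collect_le continuous_intros) auto
  ultimately show ?thesis by simp
qed

section \<open>Stability of contact pairs\<close>

text \<open>
  The limit of pairs that support \<open>D\<close> up to a vanishing error is a contact pair, so a strict
  inequality that holds at all contact pairs persists for approximate ones, with a uniform
  tolerance \<open>\<delta>\<close>. Unit vectors are used for the approximate pairs, since their compactness does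
  not depend on the error. The limit can be rescaled to a normalized pair because \<open>u\<close> is
  interior to \<open>D\<close>.
\<close>

lemma approximate_contact_pairs:
  fixes f :: "real ^ 'n \<Rightarrow> real ^ 'n"
  assumes "C \<subseteq> D" "compact C" "u \<in> interior D" "continuous_on C f"
    and neg: "\<And>y a. (y, a) \<in> normalized_contact_pairs C D u \<Longrightarrow> a \<bullet> f y < 0"
  shows "\<exists>\<delta>>0. \<forall>y\<in>C. \<forall>a. norm a = 1 \<longrightarrow> (\<forall>x\<in>D. a \<bullet> (x - y) \<le> \<delta>) \<longrightarrow> a \<bullet> f y < 0"
proof (rule ccontr)
  assume no: "\<not> ?thesis"
  define B where "B k p \<longleftrightarrow> fst p \<in> C \<and> norm (snd p) = 1 \<and>
    (\<forall>x\<in>D. snd p \<bullet> (x - fst p) \<le> 1 / real (Suc k)) \<and> snd p \<bullet> f (fst p) \<ge> 0"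
    for k :: nat and p :: "(real ^ 'n) \<times> (real ^ 'n)"
  have "\<exists>p. B k p" for k
  proof -
    have "1 / real (Suc k) > 0" by simp
    with no obtain y a where "y \<in> C" "norm a = 1"
      "\<forall>x\<in>D. a \<bullet> (x - y) \<le> 1 / real (Suc k)" "\<not> a \<bullet> f y < 0" by meson
    then show ?thesis by (intro exI[of _ "(y, a)"]) (auto simp: B_def)
  qed
  then obtain s where s: "\<And>k. B k (s k)" by metis
  have "compact (C \<times> sphere (0 :: real ^ 'n) 1)"
    using assms(2) by (intro compact_Times) auto
  moreover have "\<forall>k. s k \<in> C \<times> sphere 0 1"
    using s by (auto simp: B_def mem_Times_iff)
  ultimately obtain l \<rho> where l: "l \<in> C \<times> sphere 0 1" and \<rho>: "strict_mono \<rho>"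
    and lim: "(s \<circ> \<rho>) \<longlonglongrightarrow> l"
    unfolding compact_def by meson
  obtain y a where ya: "l = (y, a)" by (cases l)
  have y: "y \<in> C" and a: "norm a = 1" using l ya by auto
  have limy: "(\<lambda>k. fst (s (\<rho> k))) \<longlonglongrightarrow> y" and lima: "(\<lambda>k. snd (s (\<rho> k))) \<longlonglongrightarrow> a"
    using tendsto_fst[OF lim] tendsto_snd[OF lim] ya by (auto simp: o_def)
  have supp: "a \<bullet> (x - y) \<le> 0" if "x \<in> D" for x
  proof (rule LIMSEQ_le)
    show "(\<lambda>k. snd (s (\<rho> k)) \<bullet> (x - fst (s (\<rho> k)))) \<longlonglongrightarrow> a \<bullet> (x - y)"
      by (intro tendsto_intros limy lima)
    show "(\<lambda>k. 1 / real (Suc (\<rho> k))) \<longlonglongrightarrow> 0"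
      using LIMSEQ_subseq_LIMSEQ[OF lim_inverse_n' [THEN LIMSEQ_Suc] \<rho>]
      by (simp add: o_def inverse_eq_divide)
    show "\<exists>N. \<forall>k\<ge>N. snd (s (\<rho> k)) \<bullet> (x - fst (s (\<rho> k))) \<le> 1 / real (Suc (\<rho> k))"
      using s that by (auto simp: B_def)
  qed
  have "(\<lambda>k. f (fst (s (\<rho> k)))) \<longlonglongrightarrow> f y"
    using continuous_on_tendsto_compose[OF assms(4) limy y] s by (auto simp: B_def)
  then have "(\<lambda>k. snd (s (\<rho> k)) \<bullet> f (fst (s (\<rho> k)))) \<longlonglongrightarrow> a \<bullet> f y"
    by (intro tendsto_intros lima)
  then have nonneg: "a \<bullet> f y \<ge> 0"
    by (rule LIMSEQ_le_const) (use s in \<open>auto simp: B_def\<close>)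
  have "a \<bullet> u < a \<bullet> y"
    by (rule inner_interior_less_support[OF assms(3)]) (use a supp in \<open>auto simp: inner_diff_right\<close>)
  then have q: "a \<bullet> (y - u) > 0" by (simp add: inner_diff_right)
  define a' where "a' = (1 / (a \<bullet> (y - u))) *\<^sub>R a"
  have "(y, a') \<in> normalized_contact_pairs C D u"
    unfolding normalized_contact_pairs_def
    using contact_pair_iff[OF assms(1) compact_imp_closed[OF assms(2)]] y a q supp
    by (auto simp: a'_def divide_right_mono inner_diff_right diff_divide_distrib[symmetric])
  from neg[OF this] have "a \<bullet> f y / (a \<bullet> (y - u)) < 0" by (simp add: a'_def)
  with nonneg q show False by (simp add: divide_less_0_iff)
qed

lemma unit_separation:
  fixes p :: "'a::euclidean_space"
  assumes "convex S" "compact S" "p \<notin> S"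
  shows "\<exists>a. norm a = 1 \<and> (\<forall>x\<in>S. a \<bullet> x \<le> a \<bullet> p)"
proof -
  obtain a b where ab: "a \<bullet> p < b" "\<forall>x\<in>S. a \<bullet> x > b"
    using separating_hyperplane_closed_point[of S p] assms compact_imp_closed by blast
  show ?thesis
  proof (cases "S = {}")
    case True
    then show ?thesis using vector_choose_size[of 1] by auto
  next
    case False
    then have "a \<noteq> 0" using ab by auto
    then show ?thesis using ab
      by (intro exI[of _ "- (1 / norm a) *\<^sub>R a"]) (force simp: divide_right_mono)
  qed
qed

section \<open>First-order perturbations\<close>

text \<open>
  If a moved point \<open>x + \<epsilon> (A x + w)\<close> escaped from the rescaled body, a separating unit vector
  \<open>b\<close> would support \<open>D\<close> at \<open>x\<close> up to an error of order \<open>\<epsilon>\<close>. Testing the separation against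
  the point \<open>x \<in> D\<close> itself cancels the terms of order zero and leaves
  \<open>\<langle>b, A x + w\<rangle> \<ge> t \<langle>b, x - d\<rangle>\<close>, which stability of contact pairs forbids.
\<close>

lemma perturbed_outer_containment:
  fixes A :: "real ^ 'n ^ 'n"
  assumes "K \<subseteq> D" "compact K" "compact D" "convex D" "d \<in> interior D"
    and lt: "\<And>z b. (z, b) \<in> normalized_contact_pairs K D d \<Longrightarrow> b \<bullet> (A *v z + w) < t"
  shows "\<exists>\<epsilon>\<^sub>0>0. \<forall>\<epsilon>. 0 < \<epsilon> \<longrightarrow> \<epsilon> < \<epsilon>\<^sub>0 \<longrightarrow>
           (\<lambda>x. x + \<epsilon> *\<^sub>R (A *v x + w)) ` K \<subseteq> (\<lambda>p. d + (1 + \<epsilon> * t) *\<^sub>R (p - d)) ` D"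
proof -
  define f where "f x = A *v x + w - t *\<^sub>R (x - d)" for x
  have cont: "continuous_on X (\<lambda>x. A *v x)" for X
    by (simp add: linear_continuous_on matrix_vector_mul_bounded_linear)
  have "continuous_on K f"
    unfolding f_def by (intro continuous_intros cont)
  moreover have "b \<bullet> f z < 0" if "(z, b) \<in> normalized_contact_pairs K D d" for z b
  proof -
    have "b \<bullet> f z = b \<bullet> (A *v z + w) - t * (b \<bullet> (z - d))"
      by (simp only: f_def inner_diff_right inner_scaleR_right)
    then show ?thesis using lt[OF that] that by (simp add: normalized_contact_pairs_def)
  qed
  ultimately obtain \<delta> where \<delta>: "\<delta> > 0" and stable:
    "\<And>x b. x \<in> K \<Longrightarrow> norm b = 1 \<Longrightarrow> \<forall>p\<in>D. b \<bullet> (p - x) \<le> \<delta> \<Longrightarrow> b \<bullet> f x < 0"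
    using approximate_contact_pairs[OF assms(1,2,5)] by metis
  have "bounded ((\<lambda>x. A *v x + w) ` K)" "bounded ((\<lambda>p. t *\<^sub>R (p - d)) ` D)"
    using assms(2,3) by (auto intro!: compact_imp_bounded compact_continuous_image continuous_intros cont)
  then obtain M1 M2 where M: "M1 > 0" "M2 > 0" "\<And>x. x \<in> K \<Longrightarrow> norm (A *v x + w) \<le> M1"
    "\<And>p. p \<in> D \<Longrightarrow> norm (t *\<^sub>R (p - d)) \<le> M2"
    by (auto simp: bounded_pos)
  \<comment> \<open>The first bound keeps \<open>1 + \<epsilon> t\<close> positive, the second the support error below \<open>\<delta>\<close>.\<close>
  define e0 where "e0 = min (1 / (\<bar>t\<bar> + 1)) (\<delta> / (M1 + M2))"
  show ?thesis
  proof (intro exI[of _ e0] conjI allI impI subsetI)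
    show "e0 > 0" using \<delta> M by (auto simp: e0_def)
    fix \<epsilon> :: real and q
    assume e: "0 < \<epsilon>" "\<epsilon> < e0" and "q \<in> (\<lambda>x. x + \<epsilon> *\<^sub>R (A *v x + w)) ` K"
    then obtain x where x: "x \<in> K" and q: "q = x + \<epsilon> *\<^sub>R (A *v x + w)" by auto
    have "\<epsilon> * (\<bar>t\<bar> + 1) < 1" using e by (simp add: e0_def field_simps)
    moreover have "\<epsilon> * t \<ge> - (\<epsilon> * (\<bar>t\<bar> + 1))"
      using e mult_left_mono[of "-(\<bar>t\<bar> + 1)" t \<epsilon>] by (simp add: algebra_simps)
    ultimately have pos: "1 + \<epsilon> * t > 0" by linarith
    have small: "\<epsilon> * (M1 + M2) \<le> \<delta>" using e M by (simp add: e0_def field_simps)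
    show "q \<in> (\<lambda>p. d + (1 + \<epsilon> * t) *\<^sub>R (p - d)) ` D"
    proof (rule ccontr)
      assume notin: "q \<notin> (\<lambda>p. d + (1 + \<epsilon> * t) *\<^sub>R (p - d)) ` D"
      have eq: "(\<lambda>p. d + (1 + \<epsilon> * t) *\<^sub>R (p - d)) =
                (\<lambda>p. (d - (1 + \<epsilon> * t) *\<^sub>R d) + (1 + \<epsilon> * t) *\<^sub>R p)"
        by (auto simp: algebra_simps)
      have "convex ((\<lambda>p. d + (1 + \<epsilon> * t) *\<^sub>R (p - d)) ` D)"
        unfolding eq using assms(4) convex_affinity by blast
      moreover have "compact ((\<lambda>p. d + (1 + \<epsilon> * t) *\<^sub>R (p - d)) ` D)"
        using assms(3) by (intro compact_continuous_image continuous_intros)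
      ultimately obtain b where b: "norm b = 1" and
        sep: "\<And>p. p \<in> D \<Longrightarrow> b \<bullet> (d + (1 + \<epsilon> * t) *\<^sub>R (p - d)) \<le> b \<bullet> q"
        using unit_separation[OF _ _ notin] by blast
      have le: "b \<bullet> (p - x) \<le> \<epsilon> * (b \<bullet> (A *v x + w) - t * (b \<bullet> (p - d)))" if "p \<in> D" for p
        using sep[OF that] by (simp add: q algebra_simps inner_simps)
      have "b \<bullet> (p - x) \<le> \<delta>" if p: "p \<in> D" for p
      proof -
        have "b \<bullet> (A *v x + w) \<le> M1"
          using norm_cauchy_schwarz[of b "A *v x + w"] M(3)[OF x] b by simp
        moreover have "- (t * (b \<bullet> (p - d))) \<le> M2"
          using norm_cauchy_schwarz[of "-b" "t *\<^sub>R (p - d)"] M(4)[OF p] b by simp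
        ultimately have "\<epsilon> * (b \<bullet> (A *v x + w) - t * (b \<bullet> (p - d))) \<le> \<epsilon> * (M1 + M2)"
          using e by (intro mult_left_mono) auto
        then show ?thesis using le[OF p] small by linarith
      qed
      then have "b \<bullet> f x < 0" using stable[OF x b] by blast
      moreover have "0 \<le> \<epsilon> * (b \<bullet> f x)"
        using le[of x] x assms(1) by (auto simp: f_def inner_diff_right)
      ultimately show False using e by (simp add: zero_le_mult_iff)
    qed
  qed
qed

text \<open>
  The same argument with the roles exchanged: a point of the rescaled inner body outside the
  moved \<open>K\<close> is separated from it, and the separation is tested against the image of the
  corresponding point \<open>y \<in> C \<subseteq> K\<close>. Separating from the image of \<open>K\<close> avoids inverting
  \<open>I + \<epsilon> A\<close>.
\<close>

lemma perturbed_inner_containment: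
  fixes A :: "real ^ 'n ^ 'n"
  assumes "C \<subseteq> K" "compact C" "compact K" "convex K" "c \<in> interior K"
    and gt: "\<And>y a. (y, a) \<in> normalized_contact_pairs C K c \<Longrightarrow> a \<bullet> (A *v y + v) > t"
  shows "\<exists>\<epsilon>\<^sub>0>0. \<forall>\<epsilon>. 0 < \<epsilon> \<longrightarrow> \<epsilon> < \<epsilon>\<^sub>0 \<longrightarrow>
           (\<lambda>p. c + (1 + \<epsilon> * t) *\<^sub>R (p - c)) ` C \<subseteq> (\<lambda>x. x + \<epsilon> *\<^sub>R (A *v x + v)) ` K"
proof -
  define f where "f y = t *\<^sub>R (y - c) - (A *v y + v)" for y
  have cont: "continuous_on X (\<lambda>x. A *v x)" for X
    by (simp add: linear_continuous_on matrix_vector_mul_bounded_linear)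
  have "continuous_on C f"
    unfolding f_def by (intro continuous_intros cont)
  moreover have "a \<bullet> f y < 0" if "(y, a) \<in> normalized_contact_pairs C K c" for y a
  proof -
    have "a \<bullet> f y = t * (a \<bullet> (y - c)) - a \<bullet> (A *v y + v)"
      by (simp only: f_def inner_diff_right inner_scaleR_right)
    then show ?thesis using gt[OF that] that by (simp add: normalized_contact_pairs_def)
  qed
  ultimately obtain \<delta> where \<delta>: "\<delta> > 0" and stable:
    "\<And>y a. y \<in> C \<Longrightarrow> norm a = 1 \<Longrightarrow> \<forall>x\<in>K. a \<bullet> (x - y) \<le> \<delta> \<Longrightarrow> a \<bullet> f y < 0"
    using approximate_contact_pairs[OF assms(1,2,5)] by metis
  have "bounded ((\<lambda>x. A *v x + v) ` K)" "bounded ((\<lambda>p. t *\<^sub>R (p - c)) ` C)"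
    using assms(2,3) by (auto intro!: compact_imp_bounded compact_continuous_image continuous_intros cont)
  then obtain M1 M2 where M: "M1 > 0" "M2 > 0" "\<And>x. x \<in> K \<Longrightarrow> norm (A *v x + v) \<le> M1"
    "\<And>p. p \<in> C \<Longrightarrow> norm (t *\<^sub>R (p - c)) \<le> M2"
    by (auto simp: bounded_pos)
  define e0 where "e0 = \<delta> / (M1 + M2)"
  show ?thesis
  proof (intro exI[of _ e0] conjI allI impI subsetI)
    show "e0 > 0" using \<delta> M by (auto simp: e0_def)
    fix \<epsilon> :: real and q
    assume e: "0 < \<epsilon>" "\<epsilon> < e0" and "q \<in> (\<lambda>p. c + (1 + \<epsilon> * t) *\<^sub>R (p - c)) ` C"
    then obtain y where y: "y \<in> C" and q: "q = c + (1 + \<epsilon> * t) *\<^sub>R (y - c)" by auto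
    have small: "\<epsilon> * (M1 + M2) \<le> \<delta>" using e M by (simp add: e0_def field_simps)
    show "q \<in> (\<lambda>x. x + \<epsilon> *\<^sub>R (A *v x + v)) ` K"
    proof (rule ccontr)
      assume notin: "q \<notin> (\<lambda>x. x + \<epsilon> *\<^sub>R (A *v x + v)) ` K"
      have eq: "(\<lambda>x. x + \<epsilon> *\<^sub>R (A *v x + v)) ` K = (\<lambda>x. \<epsilon> *\<^sub>R v + x) ` (\<lambda>x. x + \<epsilon> *\<^sub>R (A *v x)) ` K"
        by (auto simp: image_image algebra_simps)
      have "linear (\<lambda>x. x + \<epsilon> *\<^sub>R (A *v x))"
        by (rule linearI) (auto simp: matrix_vector_right_distrib matrix_vector_mult_scaleR algebra_simps)
      then have "convex ((\<lambda>x. x + \<epsilon> *\<^sub>R (A *v x + v)) ` K)"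
        unfolding eq using assms(4) by (intro convex_translation convex_linear_image)
      moreover have "compact ((\<lambda>x. x + \<epsilon> *\<^sub>R (A *v x + v)) ` K)"
        using assms(3) by (intro compact_continuous_image continuous_intros cont)
      ultimately obtain a where a: "norm a = 1" and
        sep: "\<And>x. x \<in> K \<Longrightarrow> a \<bullet> (x + \<epsilon> *\<^sub>R (A *v x + v)) \<le> a \<bullet> q"
        using unit_separation[OF _ _ notin] by blast
      have le: "a \<bullet> (x - y) \<le> \<epsilon> * (t * (a \<bullet> (y - c)) - a \<bullet> (A *v x + v))" if "x \<in> K" for x
        using sep[OF that] by (simp add: q algebra_simps inner_simps)
      have "a \<bullet> (x - y) \<le> \<delta>" if x: "x \<in> K" for x
      proof -
        have "- (a \<bullet> (A *v x + v)) \<le> M1"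
          using norm_cauchy_schwarz[of "-a" "A *v x + v"] M(3)[OF x] a by simp
        moreover have "t * (a \<bullet> (y - c)) \<le> M2"
          using norm_cauchy_schwarz[of a "t *\<^sub>R (y - c)"] M(4)[OF y] a by simp
        ultimately have "\<epsilon> * (t * (a \<bullet> (y - c)) - a \<bullet> (A *v x + v)) \<le> \<epsilon> * (M1 + M2)"
          using e by (intro mult_left_mono) auto
        then show ?thesis using le[OF x] small by linarith
      qed
      then have "a \<bullet> f y < 0" using stable[OF y a] by blast
      moreover have "0 \<le> \<epsilon> * (a \<bullet> f y)"
        using le[of y] y assms(1) by (auto simp: f_def inner_diff_right)
      ultimately show False using e by (simp add: zero_le_mult_iff)
    qed
  qed
qed

lemma homothet_rescale:
  "homothet (s * \<rho>) L u = (\<lambda>p. u + s *\<^sub>R (p - u)) ` homothet \<rho> L u"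
  by (simp add: homothet_def image_image add.commute)

lemma homothet_translate:
  "homothet s L (u - x) = (\<lambda>p. p - x) ` homothet s L u"
  by (simp add: homothet_def image_image algebra_simps)

lemma compact_homothet: "compact L \<Longrightarrow> compact (homothet s L u)"
  unfolding homothet_def by (intro compact_continuous_image continuous_intros)

lemma convex_homothet: "convex L \<Longrightarrow> convex (homothet s L u)"
  unfolding homothet_def using convex_affinity[of L u s] by (simp add: add.commute)

lemma center_in_interior_homothet:
  assumes "0 \<in> interior L" "s > 0"
  shows "u \<in> interior (homothet s L u)"
proof -
  have "homothet s (interior L) u = (\<lambda>x. u + s *\<^sub>R x) ` interior L"
    by (simp add: homothet_def add.commute)
  then have "open (homothet s (interior L) u)"
    using assms(2) open_affinity[of "interior L" s u] by simp
  moreover have "homothet s (interior L) u \<subseteq> homothet s L u"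
    unfolding homothet_def using interior_subset by blast
  moreover have "u \<in> homothet s (interior L) u"
    using assms(1) by (force simp: homothet_def)
  ultimately show ?thesis by (metis interiorI)
qed

text \<open>
  The linear map \<open>I + \<epsilon> A\<close> serves both containments at once. The translations \<open>\<epsilon> v\<close> and
  \<open>\<epsilon> w\<close> may differ, since they are absorbed into the free centres of the two homothets. If
  \<open>t < t'\<close>, the new ratio \<open>(1 + \<epsilon> t) R / ((1 + \<epsilon> t') r)\<close> would beat \<open>R / r\<close>.
\<close>

lemma affinely_optimal_first_order:
  fixes A :: "real ^ 'n ^ 'n"
  assumes opt: "affinely_optimal r L1 c K R L2 d"
    and bodies: "convex_body K" "convex_body L1" "convex_body L2"
    and cent: "0 \<in> interior L1" "0 \<in> interior L2" and pos: "r > 0" "R > 0"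
    and gt: "\<And>y a. (y, a) \<in> normalized_contact_pairs (homothet r L1 c) K c \<Longrightarrow> a \<bullet> (A *v y + v) > t'"
    and lt: "\<And>z b. (z, b) \<in> normalized_contact_pairs K (homothet R L2 d) d \<Longrightarrow> b \<bullet> (A *v z + w) < t"
  shows "t' \<le> t"
proof (rule ccontr)
  assume "\<not> t' \<le> t"
  then have tt: "t < t'" by simp
  have sub: "homothet r L1 c \<subseteq> K" "K \<subseteq> homothet R L2 d"
    using opt by (auto simp: affinely_optimal_def)
  have cK: "c \<in> interior K"
    using center_in_interior_homothet[OF cent(1) pos(1)] interior_mono[OF sub(1)] by blast
  obtain e1 where e1: "e1 > 0" "\<And>\<epsilon>. 0 < \<epsilon> \<Longrightarrow> \<epsilon> < e1 \<Longrightarrow>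
      (\<lambda>p. c + (1 + \<epsilon> * t') *\<^sub>R (p - c)) ` homothet r L1 c \<subseteq> (\<lambda>x. x + \<epsilon> *\<^sub>R (A *v x + v)) ` K"
    using perturbed_inner_containment[OF sub(1) _ _ _ cK gt] bodies compact_homothet
    unfolding convex_body_def by meson
  obtain e2 where e2: "e2 > 0" "\<And>\<epsilon>. 0 < \<epsilon> \<Longrightarrow> \<epsilon> < e2 \<Longrightarrow>
      (\<lambda>x. x + \<epsilon> *\<^sub>R (A *v x + w)) ` K \<subseteq> (\<lambda>p. d + (1 + \<epsilon> * t) *\<^sub>R (p - d)) ` homothet R L2 d"
    using perturbed_outer_containment[OF sub(2) _ _ _ center_in_interior_homothet[OF cent(2) pos(2)] lt]
      bodies compact_homothet convex_homothet
    unfolding convex_body_def by meson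
  have "0 < min e1 (min e2 (1 / (\<bar>t\<bar> + 1)))" using e1(1) e2(1) by simp
  then obtain \<epsilon> where "0 < \<epsilon>" "\<epsilon> < min e1 (min e2 (1 / (\<bar>t\<bar> + 1)))"
    using dense by blast
  then have e: "0 < \<epsilon>" "\<epsilon> < e1" "\<epsilon> < e2" "\<epsilon> < 1 / (\<bar>t\<bar> + 1)" by simp_all
  have "\<epsilon> * (\<bar>t\<bar> + 1) < 1" using e by (simp add: field_simps)
  moreover have "\<epsilon> * t \<ge> - (\<epsilon> * (\<bar>t\<bar> + 1))"
    using e mult_left_mono[of "-(\<bar>t\<bar> + 1)" t \<epsilon>] by (simp add: algebra_simps)
  ultimately have p: "1 + \<epsilon> * t > 0" by linarith
  have p': "1 + \<epsilon> * t < 1 + \<epsilon> * t'" using tt e by simp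
  define T where "T x = x + \<epsilon> *\<^sub>R (A *v x)" for x
  have lin: "linear T"
    unfolding T_def
    by (rule linearI) (auto simp: matrix_vector_right_distrib matrix_vector_mult_scaleR algebra_simps)
  have shift: "T ` K = (\<lambda>p. p - \<epsilon> *\<^sub>R v) ` (\<lambda>x. x + \<epsilon> *\<^sub>R (A *v x + v)) ` K" for v
    by (simp add: T_def image_image algebra_simps)
  have "homothet ((1 + \<epsilon> * t') * r) L1 (c - \<epsilon> *\<^sub>R v) \<subseteq> T ` K"
    unfolding homothet_translate homothet_rescale shift[of v] using e1(2)[of \<epsilon>] e by blast
  moreover have "T ` K \<subseteq> homothet ((1 + \<epsilon> * t) * R) L2 (d - \<epsilon> *\<^sub>R w)"
    unfolding homothet_translate homothet_rescale shift[of w] using e2(2)[of \<epsilon>] e by blast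
  moreover have "(1 + \<epsilon> * t') * r > 0" "(1 + \<epsilon> * t) * R > 0"
    using p p' pos by auto
  ultimately have "((1 + \<epsilon> * t) * R) / ((1 + \<epsilon> * t') * r) \<ge> R / r"
    using opt lin unfolding affinely_optimal_def by blast
  then have "R * ((1 + \<epsilon> * t') * r) \<le> (1 + \<epsilon> * t) * R * r"
    using p p' pos by (simp add: divide_simps mult_ac split: if_splits)
  then have "(1 + \<epsilon> * t') * (R * r) \<le> (1 + \<epsilon> * t) * (R * r)" by (simp add: mult_ac)
  then show False using p' pos by simp
qed

section \<open>The decomposition\<close>

text \<open>The rank-one matrix \<open>a y\<^sup>T\<close>, which represents \<open>A \<mapsto> \<langle>a, A y\<rangle>\<close> in the trace inner product.\<close>

definition dyad :: "real ^ 'n \<Rightarrow> real ^ 'n \<Rightarrow> real ^ 'n ^ 'n" where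
  "dyad a y = (\<chi> i j. a $ i * y $ j)"

lemma inner_dyad: "A \<bullet> dyad a y = a \<bullet> (A *v y)"
  by (simp add: inner_vec_def dyad_def matrix_vector_mult_def sum_distrib_left mult_ac)

lemma vector_mult_dyad: "x v* dyad a y = (x \<bullet> a) *\<^sub>R y"
  by (simp add: vec_eq_iff dyad_def vector_matrix_mult_def inner_vec_def sum_distrib_left mult_ac)

lemma continuous_on_dyad [continuous_intros]:
  "continuous_on X f \<Longrightarrow> continuous_on X g \<Longrightarrow> continuous_on X (\<lambda>p. dyad (f p) (g p))"
  unfolding dyad_def by (intro continuous_intros)

text \<open>
  The minus sign at \<open>b z\<^sup>T\<close> turns the coincidence of two combinations into the vanishing of
  one, so that a single application of Caratheodory's theorem bounds the total number of
  contact pairs. The separating functional exceeds some \<open>\<beta> > 0\<close> on the hull, which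
  supplies the gap between the rates \<open>-\<beta>\<close> and \<open>\<beta>\<close>.
\<close>

lemma affinely_optimal_zero_in_hull:
  fixes K L1 L2 :: "(real ^ 'n) set"
  assumes opt: "affinely_optimal r L1 c K R L2 d"
    and bodies: "convex_body K" "convex_body L1" "convex_body L2"
    and cent: "0 \<in> interior L1" "0 \<in> interior L2" and pos: "r > 0" "R > 0"
  shows "0 \<in> convex hull
    ((\<lambda>(y, a). (dyad a y, a, 0)) ` normalized_contact_pairs (homothet r L1 c) K c \<union>
     (\<lambda>(z, b). (- dyad b z, 0, b)) ` normalized_contact_pairs K (homothet R L2 d) d)"
    (is "0 \<in> convex hull (?f ` ?P \<union> ?g ` ?Q)")
proof (rule ccontr)
  assume no: "0 \<notin> convex hull (?f ` ?P \<union> ?g ` ?Q)"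
  have sub: "homothet r L1 c \<subseteq> K" "K \<subseteq> homothet R L2 d"
    using opt by (auto simp: affinely_optimal_def)
  have cK: "c \<in> interior K"
    using center_in_interior_homothet[OF cent(1) pos(1)] interior_mono[OF sub(1)] by blast
  have "compact ?P" "compact ?Q"
    using bodies sub cK center_in_interior_homothet[OF cent(2) pos(2)] compact_homothet
    by (auto intro!: compact_normalized_contact_pairs simp: convex_body_def)
  then have "compact (?f ` ?P \<union> ?g ` ?Q)"
    unfolding case_prod_unfold
    by (intro compact_Un compact_continuous_image continuous_intros)
  then have "closed (convex hull (?f ` ?P \<union> ?g ` ?Q))"
    using compact_convex_hull compact_imp_closed by blast
  then obtain q \<beta> where q: "\<beta> > 0" "\<forall>x \<in> convex hull (?f ` ?P \<union> ?g ` ?Q). q \<bullet> x > \<beta>"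
    using separating_hyperplane_closed_0[OF convex_convex_hull _ no] by blast
  obtain A v w where Avw: "q = (A, v, w)" by (cases q)
  have "\<beta> \<le> - \<beta>"
  proof (rule affinely_optimal_first_order[OF opt bodies cent pos, of \<beta> A v "- w" "- \<beta>"])
    fix y a assume "(y, a) \<in> ?P"
    then have "?f (y, a) \<in> convex hull (?f ` ?P \<union> ?g ` ?Q)" by (intro hull_inc) blast
    then have "q \<bullet> ?f (y, a) > \<beta>" using q(2) by blast
    then show "a \<bullet> (A *v y + v) > \<beta>"
      by (simp add: Avw inner_dyad inner_add_right inner_commute[of v])
  next
    fix z b assume "(z, b) \<in> ?Q"
    then have "?g (z, b) \<in> convex hull (?f ` ?P \<union> ?g ` ?Q)" by (intro hull_inc) blast
    then have "q \<bullet> ?g (z, b) > \<beta>" using q(2) by blast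
    then show "b \<bullet> (A *v z + - w) < - \<beta>"
      by (simp add: Avw inner_dyad inner_diff_right inner_commute[of w])
  qed
  then show False using q(1) by simp
qed

text \<open>
  Each side is the trace of \<open>f\<close> composed with the corresponding operator
  \<open>x \<mapsto> \<Sum>i. \<lambda> i \<langle>x, a i\<rangle> y i\<close>, and the two operators coincide.
\<close>

lemma decomposition_trace:
  fixes y z a b :: "nat \<Rightarrow> real ^ 'n"
  assumes "\<And>x. (\<Sum>i\<in>I. (lam i * (x \<bullet> a i)) *\<^sub>R y i) = (\<Sum>j\<in>J. (mu j * (x \<bullet> b j)) *\<^sub>R z j)"
    and "linear f"
  shows "(\<Sum>i\<in>I. lam i * (a i \<bullet> f (y i))) = (\<Sum>j\<in>J. mu j * (b j \<bullet> f (z j)))"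
proof -
  have expand: "(\<Sum>i\<in>I. lam i * (a i \<bullet> f (y i))) =
      (\<Sum>e\<in>Basis. e \<bullet> f (\<Sum>i\<in>I. (lam i * (e \<bullet> a i)) *\<^sub>R y i))"
    for I lam and a y :: "nat \<Rightarrow> real ^ 'n"
  proof -
    have "(\<Sum>e\<in>Basis. e \<bullet> f (\<Sum>i\<in>I. (lam i * (e \<bullet> a i)) *\<^sub>R y i)) =
        (\<Sum>e\<in>Basis. \<Sum>i\<in>I. lam i * ((a i \<bullet> e) * (f (y i) \<bullet> e)))"
      by (simp add: linear_sum[OF assms(2)] linear_cmul[OF assms(2)] inner_sum_right
          inner_commute mult_ac)
    also have "\<dots> = (\<Sum>i\<in>I. lam i * (\<Sum>e\<in>Basis. (a i \<bullet> e) * (f (y i) \<bullet> e)))"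
      by (subst sum.swap) (simp add: sum_distrib_left)
    finally show ?thesis by (simp add: euclidean_inner[symmetric])
  qed
  show ?thesis unfolding expand assms(1) ..
qed

text \<open>Moving the centre \<open>u\<close> to the origin costs nothing because the normals are balanced.\<close>

lemma normalized_weight_sum:
  fixes y a :: "nat \<Rightarrow> real ^ 'n"
  assumes "\<And>i. i \<in> I \<Longrightarrow> a i \<bullet> (y i - u) = 1" and "(\<Sum>i\<in>I. lam i *\<^sub>R a i) = 0"
  shows "(\<Sum>i\<in>I. lam i) = (\<Sum>i\<in>I. lam i * (a i \<bullet> y i))"
proof -
  have "(\<Sum>i\<in>I. lam i * (a i \<bullet> y i)) = (\<Sum>i\<in>I. lam i + lam i * (a i \<bullet> u))"
    using assms(1) by (intro sum.cong) (auto simp: inner_diff_right algebra_simps)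
  also have "\<dots> = (\<Sum>i\<in>I. lam i) + (\<Sum>i\<in>I. lam i *\<^sub>R a i) \<bullet> u"
    by (simp add: sum.distrib inner_sum_left)
  finally show ?thesis using assms(2) by simp
qed

text \<open>
  Caratheodory's theorem yields at most \<open>n\<^sup>2 + 2 n + 1\<close> points. Those that come from an inner
  pair form one family and the remaining ones the other. Both families are nonempty, because
  their total weights are equal by the trace identity and add up to \<open>1\<close>.
\<close>

lemma zero_in_hull_imp_decomposition:
  fixes Inner K Outer :: "(real ^ 'n) set"
  assumes zero: "0 \<in> convex hull
    ((\<lambda>(y, a). (dyad a y, a, 0)) ` normalized_contact_pairs Inner K c \<union>
     (\<lambda>(z, b). (- dyad b z, 0, b)) ` normalized_contact_pairs K Outer d)"
  shows "\<exists>N y a lam M z b mu. contact_decomposition Inner K Outer N y a lam M z b mu \<and>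
     N + M \<le> (CARD('n) + 1)\<^sup>2 \<and>
     (\<forall>i\<in>{1..N}. a i \<bullet> (y i - c) = 1) \<and> (\<forall>j\<in>{1..M}. b j \<bullet> (z j - d) = 1)"
proof -
  let ?f = "\<lambda>(y, a). (dyad a y, a, 0) :: (real ^ 'n ^ 'n) \<times> (real ^ 'n) \<times> (real ^ 'n)"
  let ?g = "\<lambda>(z, b). (- dyad b z, 0, b) :: (real ^ 'n ^ 'n) \<times> (real ^ 'n) \<times> (real ^ 'n)"
  let ?P = "normalized_contact_pairs Inner K c" and ?Q = "normalized_contact_pairs K Outer d"
  obtain S where S: "finite S" "S \<subseteq> ?f ` ?P \<union> ?g ` ?Q"
    "card S \<le> DIM((real ^ 'n ^ 'n) \<times> (real ^ 'n) \<times> (real ^ 'n)) + 1" "0 \<in> convex hull S"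
    using zero unfolding caratheodory[of "?f ` ?P \<union> ?g ` ?Q"] by blast
  obtain \<omega> where \<omega>: "\<forall>s\<in>S. 0 \<le> \<omega> s" "sum \<omega> S = 1" "(\<Sum>s\<in>S. \<omega> s *\<^sub>R s) = 0"
    using S(1,4) unfolding convex_hull_finite[OF S(1)] by blast
  \<comment> \<open>Points of weight zero are dropped, since the weights of a decomposition are positive.\<close>
  define S1 where "S1 = {s\<in>S. \<omega> s > 0 \<and> s \<in> ?f ` ?P}"
  define S2 where "S2 = {s\<in>S. \<omega> s > 0 \<and> s \<notin> ?f ` ?P}"
  have fin: "finite S1" "finite S2" and disj: "S1 \<inter> S2 = {}"
    using S(1) by (auto simp: S1_def S2_def)
  have card_le: "card S1 + card S2 \<le> (CARD('n) + 1)\<^sup>2"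
  proof -
    have "card S1 + card S2 = card (S1 \<union> S2)" using fin disj by (simp add: card_Un_disjoint)
    also have "\<dots> \<le> card S" using S(1) by (intro card_mono) (auto simp: S1_def S2_def)
    finally show ?thesis using S(3) by (simp add: power2_eq_square)
  qed
  have split: "sum h S = sum h S1 + sum h S2" if "\<And>s. s \<in> S \<Longrightarrow> \<omega> s = 0 \<Longrightarrow> h s = 0"
    for h :: "_ \<Rightarrow> 'z::comm_monoid_add"
  proof -
    have "sum h S = sum h (S1 \<union> S2)"
      using S(1) that \<omega>(1) by (intro sum.mono_neutral_right) (force simp: S1_def S2_def)+
    then show ?thesis using fin disj by (simp add: sum.union_disjoint)
  qed
  define N where "N = card S1"
  define M where "M = card S2"
  obtain h1 h2 where h: "bij_betw h1 {1..N} S1" "bij_betw h2 {1..M} S2"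
    using ex_bij_betw_nat_finite_1 fin unfolding N_def M_def by meson
  define p where "p = inv_into ?P ?f \<circ> h1"
  define q where "q = inv_into ?Q ?g \<circ> h2"
  have p: "p i \<in> ?P \<and> h1 i = ?f (p i)" if "i \<in> {1..N}" for i
  proof -
    have mem: "h1 i \<in> ?f ` ?P" using bij_betwE[OF h(1)] that unfolding S1_def by blast
    show ?thesis
      unfolding p_def comp_def using inv_into_into[OF mem] f_inv_into_f[OF mem, symmetric] by (rule conjI)
  qed
  have q: "q j \<in> ?Q \<and> h2 j = ?g (q j)" if "j \<in> {1..M}" for j
  proof -
    have "h2 j \<in> S2" using bij_betwE[OF h(2)] that by blast
    then have mem: "h2 j \<in> ?g ` ?Q" using S(2) unfolding S2_def by blast
    show ?thesis
      unfolding q_def comp_def using inv_into_into[OF mem] f_inv_into_f[OF mem, symmetric] by (rule conjI)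
  qed
  define y where "y = fst \<circ> p"
  define a where "a = snd \<circ> p"
  define z where "z = fst \<circ> q"
  define b where "b = snd \<circ> q"
  define lam where "lam = \<omega> \<circ> h1"
  define mu where "mu = \<omega> \<circ> h2"
  have lam: "lam i > 0" if "i \<in> {1..N}" for i
    using bij_betwE[OF h(1)] that by (auto simp: lam_def S1_def)
  have mu: "mu j > 0" if "j \<in> {1..M}" for j
    using bij_betwE[OF h(2)] that by (auto simp: mu_def S2_def)
  have P: "contact_pair Inner K (y i) (a i) \<and> a i \<bullet> (y i - c) = 1" if "i \<in> {1..N}" for i
    using p[OF that] by (auto simp: normalized_contact_pairs_def y_def a_def)
  have Q: "contact_pair K Outer (z j) (b j) \<and> b j \<bullet> (z j - d) = 1" if "j \<in> {1..M}" for j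
    using q[OF that] by (auto simp: normalized_contact_pairs_def z_def b_def)
  have reindex: "(\<Sum>s\<in>S1. F s) = (\<Sum>i=1..N. F (h1 i))" "(\<Sum>s\<in>S2. F s) = (\<Sum>j=1..M. F (h2 j))"
    for F :: "_ \<Rightarrow> 'z::comm_monoid_add"
    using sum.reindex_bij_betw[OF h(1)] sum.reindex_bij_betw[OF h(2)] by metis+
  have "0 = (\<Sum>s\<in>S1. \<omega> s *\<^sub>R s) + (\<Sum>s\<in>S2. \<omega> s *\<^sub>R s)"
    using \<omega>(3) by (simp add: split)
  also have "(\<Sum>s\<in>S1. \<omega> s *\<^sub>R s) = (\<Sum>i=1..N. lam i *\<^sub>R (dyad (a i) (y i), a i, 0))"
    unfolding reindex using p
    by (intro sum.cong) (auto simp: lam_def a_def y_def case_prod_unfold)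
  also have "(\<Sum>s\<in>S2. \<omega> s *\<^sub>R s) = (\<Sum>j=1..M. mu j *\<^sub>R (- dyad (b j) (z j), 0, b j))"
    unfolding reindex using q
    by (intro sum.cong) (auto simp: mu_def b_def z_def case_prod_unfold)
  finally have eq: "(\<Sum>i=1..N. lam i *\<^sub>R dyad (a i) (y i)) = (\<Sum>j=1..M. mu j *\<^sub>R dyad (b j) (z j))"
    "(\<Sum>i=1..N. lam i *\<^sub>R a i) = 0" "(\<Sum>j=1..M. mu j *\<^sub>R b j) = 0"
    by (auto simp: prod_eq_iff fst_sum snd_sum sum_negf)
  \<comment> \<open>Applying both matrices to \<open>x\<close> from the left turns the matrix identity into that of (ii).\<close>
  have id: "(\<Sum>i=1..N. (lam i * (x \<bullet> a i)) *\<^sub>R y i) = (\<Sum>j=1..M. (mu j * (x \<bullet> b j)) *\<^sub>R z j)" for x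
  proof -
    have lin: "linear (\<lambda>B. x v* B)"
      by (rule linearI) (auto simp: vector_matrix_mult_def vec_eq_iff algebra_simps
          sum.distrib sum_distrib_left)
    have "x v* (\<Sum>i=1..N. lam i *\<^sub>R dyad (a i) (y i)) = x v* (\<Sum>j=1..M. mu j *\<^sub>R dyad (b j) (z j))"
      using eq(1) by simp
    then show ?thesis
      by (simp add: linear_sum[OF lin] linear_cmul[OF lin] vector_mult_dyad)
  qed
  have "(\<Sum>i=1..N. lam i) = (\<Sum>i=1..N. lam i * (a i \<bullet> y i))"
    using P eq(2) by (intro normalized_weight_sum) auto
  also have "\<dots> = (\<Sum>j=1..M. mu j * (b j \<bullet> z j))"
    using decomposition_trace[OF id linear_id] by simp
  also have "\<dots> = (\<Sum>j=1..M. mu j)"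
    using Q eq(3) by (intro normalized_weight_sum[symmetric]) auto
  finally have weights: "(\<Sum>i=1..N. lam i) = (\<Sum>j=1..M. mu j)" .
  have "1 = (\<Sum>i=1..N. lam i) + (\<Sum>j=1..M. mu j)"
    using \<omega>(2) split[of \<omega>] by (simp add: reindex lam_def mu_def)
  with weights have "(\<Sum>i=1..N. lam i) = 1 / 2" "(\<Sum>j=1..M. mu j) = 1 / 2" by simp_all
  then have "N \<noteq> 0" "M \<noteq> 0" by - (rule notI, simp)+
  then have "N \<ge> 1" "M \<ge> 1" by simp_all
  then have "contact_decomposition Inner K Outer N y a lam M z b mu"
    unfolding contact_decomposition_def using P Q lam mu id eq(2,3) by blast
  then show ?thesis using P Q card_le unfolding N_def[symmetric] M_def[symmetric] by blast
qed

text \<open>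
  If every inner value exceeded every outer value, so would their averages, yet the weighted
  sums agree and so do the total weights.
\<close>

lemma decomposition_imp_ordered_pairs:
  fixes A :: "real ^ 'n ^ 'n"
  assumes dec: "contact_decomposition Inner K Outer N y a lam M z b mu"
    and na: "\<forall>i\<in>{1..N}. a i \<bullet> (y i - c) = 1" and nb: "\<forall>j\<in>{1..M}. b j \<bullet> (z j - d) = 1"
  shows "\<exists>i\<in>{1..N}. \<exists>j\<in>{1..M}. a i \<bullet> (A *v y i + v) \<le> b j \<bullet> (A *v z j + w)"
proof (rule ccontr)
  assume "\<not> ?thesis"
  then have gt: "b j \<bullet> (A *v z j + w) < a i \<bullet> (A *v y i + v)" if "i \<in> {1..N}" "j \<in> {1..M}" for i j
    using that by force
  have D: "N \<ge> 1" "M \<ge> 1" "\<forall>i\<in>{1..N}. lam i > 0" "\<forall>j\<in>{1..M}. mu j > 0"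
    "\<And>x. (\<Sum>i=1..N. (lam i * (x \<bullet> a i)) *\<^sub>R y i) = (\<Sum>j=1..M. (mu j * (x \<bullet> b j)) *\<^sub>R z j)"
    "(\<Sum>i=1..N. lam i *\<^sub>R a i) = 0" "(\<Sum>j=1..M. mu j *\<^sub>R b j) = 0"
    using dec unfolding contact_decomposition_def by blast+
  define F where "F i = a i \<bullet> (A *v y i + v)" for i
  define G where "G j = b j \<bullet> (A *v z j + w)" for j
  have drop: "(\<Sum>i\<in>I. l i * (e i \<bullet> (A *v x i + u))) = (\<Sum>i\<in>I. l i * (e i \<bullet> (A *v x i)))"
    if "(\<Sum>i\<in>I. l i *\<^sub>R e i) = 0" for I :: "nat set" and l and e x :: "nat \<Rightarrow> real ^ 'n" and u
  proof -
    have "(\<Sum>i\<in>I. l i * (e i \<bullet> (A *v x i + u))) =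
        (\<Sum>i\<in>I. l i * (e i \<bullet> (A *v x i))) + (\<Sum>i\<in>I. l i *\<^sub>R e i) \<bullet> u"
      by (simp add: inner_add_right distrib_left sum.distrib inner_sum_left)
    then show ?thesis using that by simp
  qed
  have FG: "(\<Sum>i=1..N. lam i * F i) = (\<Sum>j=1..M. mu j * G j)"
    unfolding F_def G_def drop[OF D(6)] drop[OF D(7)]
    by (rule decomposition_trace[OF D(5)]) (rule matrix_vector_mul_linear)
  have "(\<Sum>i=1..N. lam i) = (\<Sum>i=1..N. lam i * (a i \<bullet> y i))"
    using na D(6) by (intro normalized_weight_sum) auto
  also have "\<dots> = (\<Sum>j=1..M. mu j * (b j \<bullet> z j))"
    using decomposition_trace[OF D(5) linear_id] by simp
  also have "\<dots> = (\<Sum>j=1..M. mu j)"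
    using nb D(7) by (intro normalized_weight_sum[symmetric]) auto
  finally have weights: "(\<Sum>i=1..N. lam i) = (\<Sum>j=1..M. mu j)" .
  \<comment> \<open>The sum over all pairs compares the averages without dividing by the total weights.\<close>
  have "0 < (\<Sum>i=1..N. \<Sum>j=1..M. lam i * mu j * (F i - G j))"
    using D(1-4) gt by (intro sum_pos) (auto simp: F_def G_def)
  also have "\<dots> = (\<Sum>i=1..N. lam i * F i) * (\<Sum>j=1..M. mu j) - (\<Sum>i=1..N. lam i) * (\<Sum>j=1..M. mu j * G j)"
    unfolding sum_product sum_subtractf[symmetric]
    by (intro sum.cong) (auto simp: algebra_simps)
  also have "\<dots> = 0" using FG weights by simp
  finally show False by simp
qed

theorem theorem1p4:
  fixes K L1 L2 :: "(real ^ 'n) set" and c d :: "real ^ 'n" and r R :: real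
  assumes "convex_body K" and "convex_body L1" and "convex_body L2"
    and "0 \<in> interior L1 \<inter> interior L2"
    and "r > 0" and "R > 0"
    and "affinely_optimal r L1 c K R L2 d"
  shows
    "(\<forall>(A :: real ^ 'n ^ 'n) v w. \<exists>y a z b.
        contact_pair (homothet r L1 c) K y a \<and> contact_pair K (homothet R L2 d) z b \<and>
        a \<bullet> (A *v y + v) \<le> b \<bullet> (A *v z + w) \<and>
        a \<bullet> (y - c) = 1 \<and> b \<bullet> (z - d) = 1) \<and>
     (\<exists>N y a lam M z b mu.
        contact_decomposition (homothet r L1 c) K (homothet R L2 d) N y a lam M z b mu) \<and>
     (\<forall>N y a lam M z b mu.
        contact_decomposition (homothet r L1 c) K (homothet R L2 d) N y a lam M z b mu \<longrightarrow>
        (\<Sum>i=1..N. lam i * (y i \<bullet> a i)) = (\<Sum>j=1..M. mu j * (z j \<bullet> b j))) \<and>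
     (\<exists>N y a lam M z b mu.
        contact_decomposition (homothet r L1 c) K (homothet R L2 d) N y a lam M z b mu \<and>
        N + M \<le> (CARD('n) + 1)\<^sup>2)"
proof -
  have "0 \<in> convex hull
    ((\<lambda>(y, a). (dyad a y, a, 0)) ` normalized_contact_pairs (homothet r L1 c) K c \<union>
     (\<lambda>(z, b). (- dyad b z, 0, b)) ` normalized_contact_pairs K (homothet R L2 d) d)"
    using assms by (intro affinely_optimal_zero_in_hull) auto
  from zero_in_hull_imp_decomposition[OF this] obtain N y a lam M z b mu
    where dec: "contact_decomposition (homothet r L1 c) K (homothet R L2 d) N y a lam M z b mu"
      and card: "N + M \<le> (CARD('n) + 1)\<^sup>2"
      and norms: "\<forall>i\<in>{1..N}. a i \<bullet> (y i - c) = 1" "\<forall>j\<in>{1..M}. b j \<bullet> (z j - d) = 1"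
    by blast
  have "\<exists>y a z b.
        contact_pair (homothet r L1 c) K y a \<and> contact_pair K (homothet R L2 d) z b \<and>
        a \<bullet> (A *v y + v) \<le> b \<bullet> (A *v z + w) \<and>
        a \<bullet> (y - c) = 1 \<and> b \<bullet> (z - d) = 1" for A :: "real ^ 'n ^ 'n" and v w
    using decomposition_imp_ordered_pairs[OF dec norms, of A v w] dec norms
    unfolding contact_decomposition_def by blast
  moreover have "(\<Sum>i=1..N. lam i * (y i \<bullet> a i)) = (\<Sum>j=1..M. mu j * (z j \<bullet> b j))"
    if dec': "contact_decomposition (homothet r L1 c) K (homothet R L2 d) N y a lam M z b mu"
    for N y a lam M z b mu
  proof -
    have "(\<Sum>i=1..N. (lam i * (x \<bullet> a i)) *\<^sub>R y i) = (\<Sum>j=1..M. (mu j * (x \<bullet> b j)) *\<^sub>R z j)" for x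
      using dec' unfolding contact_decomposition_def by blast
    from decomposition_trace[OF this linear_id] show ?thesis
      by (simp add: inner_commute)
  qed
  ultimately show ?thesis using dec card by blast
qed

end
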